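(* For the infinite square grid $SQ$, the minimum density of a RED:LD set satisfies $\frac{2}{5} \le \textrm{RED:LD}\%(SQ) \le \frac{7}{16}$.
   Context: $SQ$ is the infinite 4-regular square grid graph (the Cartesian product of two two-way infinite paths). $N(v)$ denotes the open neighborhood of $v$. A set $S \subseteq V(G)$ is a locating-dominating (LD) set if for all $u,v \in V(G)-S$: $N(v)\cap S \neq \varnothing$, and if $u \ne v$ then $N(v) \cap S \neq N(u) \cap S$. A RED:LD set is an LD set $S$ such that $S-\{v\}$ is an LD set for every $v \in S$. For an infinite graph, the density of $S$ is the ratio of the number of detectors to the number of vertices (in the usual limiting sense), and $\textrm{RED:LD}\%(G)$ is the minimum density of a RED:LD set. *)

theory Defs
  imports Complex_Main "HOL-Library.Extended_Real"
begin

text \<open>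
  A graph is given by its adjacency relation; its vertex set is the whole type \<^typ>\<open>'a\<close>.
\<close>

type_synonym 'a graph = "'a \<Rightarrow> 'a \<Rightarrow> bool"

definition two_way_infinite_path :: "int graph" where
  "two_way_infinite_path i j \<longleftrightarrow> j = i + 1 \<or> i = j + 1"

definition cartesian_product :: "'a graph \<Rightarrow> 'b graph \<Rightarrow> ('a \<times> 'b) graph" where
  "cartesian_product G H p q \<longleftrightarrow>
     (fst p = fst q \<and> H (snd p) (snd q)) \<or> (snd p = snd q \<and> G (fst p) (fst q))"

definition SQ :: "(int \<times> int) graph" where
  "SQ = cartesian_product two_way_infinite_path two_way_infinite_path"

definition open_nbhd :: "'a graph \<Rightarrow> 'a \<Rightarrow> 'a set" where
  "open_nbhd G v = {u. G v u}"

definition LD_set :: "'a graph \<Rightarrow> 'a set \<Rightarrow> bool" where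
  "LD_set G S \<longleftrightarrow>
     (\<forall>u\<in>UNIV - S. \<forall>v\<in>UNIV - S.
        open_nbhd G v \<inter> S \<noteq> {} \<and>
        (u \<noteq> v \<longrightarrow> open_nbhd G v \<inter> S \<noteq> open_nbhd G u \<inter> S))"

definition RED_LD_set :: "'a graph \<Rightarrow> 'a set \<Rightarrow> bool" where
  "RED_LD_set G S \<longleftrightarrow> LD_set G S \<and> (\<forall>v\<in>S. LD_set G (S - {v}))"

text \<open>Vertices at graph distance at most \<open>r\<close> from \<open>v\<close>, i.e. joined to \<open>v\<close> by a walk of length at most \<open>r\<close>.\<close>

definition graph_ball :: "'a graph \<Rightarrow> 'a \<Rightarrow> nat \<Rightarrow> 'a set" where
  "graph_ball G v r = {u. \<exists>k\<le>r. (G ^^ k) v u}"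

text \<open>
  Limiting (upper) density along the balls around a base vertex \<open>v\<close>. It is meaningful for
  locally finite graphs, where all these balls are finite.
\<close>

definition set_density :: "'a graph \<Rightarrow> 'a \<Rightarrow> 'a set \<Rightarrow> ereal" where
  "set_density G v S =
     limsup (\<lambda>r. ereal (real (card (S \<inter> graph_ball G v r)) / real (card (graph_ball G v r))))"

definition RED_LD_density :: "'a graph \<Rightarrow> 'a \<Rightarrow> ereal" where
  "RED_LD_density G v = (INF S\<in>{S. RED_LD_set G S}. set_density G v S)"

end

theory Submission
  imports Defs "HOL-Real_Asymp.Real_Asymp" "HOL-Library.Product_Plus"
begin

text \<open>
  Both bounds come from averaging over translates of a finite window \<open>F\<close>: if every translate of
  \<open>F\<close> contains at least (at most) \<open>m\<close> points of \<open>S\<close>, then \<open>S\<close> has density at least (at most)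
  \<open>m / card F\<close>, because balls of \<open>SQ\<close> grow polynomially.

  Lower bound: \<open>F\<close> is a closed neighbourhood. A non-detector has at least two detectors around it,
  and a detector at least one besides itself, since these must survive the removal of one detector.
  So every closed neighbourhood contains at least two of its five points.

  Upper bound: a set of period lattice \<open>\<langle>(8,0), (4,2)\<rangle>\<close> with \<open>7\<close> points in each
  \<open>8 \<times> 2\<close> box. That it is a RED:LD set is a finite check, because two vertices at distance more
  than two have disjoint neighbourhoods.
\<close>

subsection \<open>Balls of the square grid\<close>

definition l1_dist :: "int \<times> int \<Rightarrow> int \<times> int \<Rightarrow> int" where
  "l1_dist u v = \<bar>fst u - fst v\<bar> + \<bar>snd u - snd v\<bar>"

lemma SQ_iff_l1_dist: "SQ u v \<longleftrightarrow> l1_dist u v = 1"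
  unfolding SQ_def cartesian_product_def two_way_infinite_path_def l1_dist_def by linarith

lemma l1_dist_le_if_walk: "(SQ ^^ k) v u \<Longrightarrow> l1_dist v u \<le> int k"
proof (induction k arbitrary: u)
  case 0
  then show ?case by (simp add: l1_dist_def)
next
  case (Suc k)
  then obtain w where "(SQ ^^ k) v w" "SQ w u" by auto
  then have "l1_dist v w \<le> int k" "l1_dist w u = 1"
    using Suc.IH SQ_iff_l1_dist by blast+
  then show ?case unfolding l1_dist_def by linarith
qed

lemma walk_if_l1_dist: "l1_dist v u = int k \<Longrightarrow> (SQ ^^ k) v u"
proof (induction k arbitrary: u)
  case 0
  then show ?case by (auto simp: l1_dist_def prod_eq_iff)
next
  case (Suc k)
  \<comment> \<open>\<open>w\<close> is \<open>u\<close> moved one unit toward \<open>v\<close>,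
    horizontally while the columns differ and vertically afterwards, so it is the last stop of a
    shortest walk before \<open>u\<close>.\<close>
  define w where "w = (if fst u \<noteq> fst v then (fst u - sgn (fst u - fst v), snd u)
    else (fst u, snd u - sgn (snd u - snd v)))"
  have "l1_dist v w = int k" "l1_dist w u = 1"
    using Suc.prems by (auto simp: l1_dist_def w_def sgn_if abs_if split: if_splits)
  then have "(SQ ^^ k) v w" "SQ w u"
    using Suc.IH SQ_iff_l1_dist by blast+
  then show ?case by auto
qed

lemma mem_graph_ball_SQ_iff: "u \<in> graph_ball SQ v r \<longleftrightarrow> l1_dist v u \<le> int r"
proof
  assume "u \<in> graph_ball SQ v r"
  then obtain k where "k \<le> r" "(SQ ^^ k) v u" unfolding graph_ball_def by blast
  then show "l1_dist v u \<le> int r" using l1_dist_le_if_walk[of k v u] by linarith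
next
  assume r: "l1_dist v u \<le> int r"
  have "l1_dist v u = int (nat (l1_dist v u))" by (simp add: l1_dist_def)
  then have "(SQ ^^ nat (l1_dist v u)) v u" by (rule walk_if_l1_dist)
  moreover have "nat (l1_dist v u) \<le> r" using r by simp
  ultimately show "u \<in> graph_ball SQ v r" unfolding graph_ball_def by blast
qed

text \<open>Cutting the ball into horizontal rows turns its size into a sum of interval lengths. The
  pairs are ordered \<open>(y, x)\<close> because the range of \<open>x\<close> depends on
  \<open>y\<close>.\<close>

lemma graph_ball_SQ_eq_image:
  "graph_ball SQ (a, b) r =
    (\<lambda>(y, x). (a + x, b + y)) `
      (SIGMA y:{- int r..int r}. {- (int r - \<bar>y\<bar>)..int r - \<bar>y\<bar>})" (is "_ = ?f ` ?A")
proof (intro set_eqI iffI)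
  fix u assume "u \<in> graph_ball SQ (a, b) r"
  then have "l1_dist (a, b) u \<le> int r" by (simp add: mem_graph_ball_SQ_iff)
  then have "(snd u - b, fst u - a) \<in> ?A" by (auto simp: l1_dist_def)
  then have "?f (snd u - b, fst u - a) \<in> ?f ` ?A" by (rule imageI)
  then show "u \<in> ?f ` ?A" by simp
next
  fix u assume "u \<in> ?f ` ?A"
  then show "u \<in> graph_ball SQ (a, b) r"
    by (auto simp: mem_graph_ball_SQ_iff l1_dist_def)
qed

lemma sum_diamond_rows:
  "(\<Sum>y = - int r..int r. 2 * (int r - \<bar>y\<bar>) + 1) = 2 * (int r)\<^sup>2 + 2 * int r + 1"
proof (induction r)
  case 0
  then show ?case by simp
next
  case (Suc r)
  \<comment> \<open>A larger radius adds a top and a bottom row of one vertex each, and lengthens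
    every old row by two.\<close>
  have "{- int (Suc r)..int (Suc r)} =
      insert (- int (Suc r)) (insert (int (Suc r)) {- int r..int r})"
    by auto
  then have "(\<Sum>y = - int (Suc r)..int (Suc r). 2 * (int (Suc r) - \<bar>y\<bar>) + 1) =
      2 + (\<Sum>y = - int r..int r. 2 * (int (Suc r) - \<bar>y\<bar>) + 1)"
    by simp
  also have "(\<Sum>y = - int r..int r. 2 * (int (Suc r) - \<bar>y\<bar>) + 1) =
      (\<Sum>y = - int r..int r. (2 * (int r - \<bar>y\<bar>) + 1) + 2)"
    by (rule sum.cong) simp_all
  also have "\<dots> = (\<Sum>y = - int r..int r. 2 * (int r - \<bar>y\<bar>) + 1) + 2 * (2 * int r + 1)"
    by (simp add: sum.distrib)
  finally show ?case using Suc.IH by (simp add: power2_eq_square algebra_simps)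
qed

lemma finite_graph_ball_SQ: "finite (graph_ball SQ v r)"
  by (cases v) (simp add: graph_ball_SQ_eq_image)

lemma card_graph_ball_SQ: "card (graph_ball SQ v r) = 2 * r\<^sup>2 + 2 * r + 1"
proof (cases v)
  case (Pair a b)
  let ?A = "SIGMA y:{- int r..int r}. {- (int r - \<bar>y\<bar>)..int r - \<bar>y\<bar>}"
  have "card (graph_ball SQ v r) = card ?A"
    unfolding Pair graph_ball_SQ_eq_image by (rule card_image) (auto simp: inj_on_def)
  also have "\<dots> = (\<Sum>y = - int r..int r. card {- (int r - \<bar>y\<bar>)..int r - \<bar>y\<bar>})"
    by (rule card_SigmaI) auto
  finally have "int (card (graph_ball SQ v r)) =
      (\<Sum>y = - int r..int r. int (card {- (int r - \<bar>y\<bar>)..int r - \<bar>y\<bar>}))"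
    by simp
  also have "\<dots> = (\<Sum>y = - int r..int r. 2 * (int r - \<bar>y\<bar>) + 1)"
    by (rule sum.cong) auto
  also have "\<dots> = int (2 * r\<^sup>2 + 2 * r + 1)"
    unfolding sum_diamond_rows by simp
  finally show ?thesis by (simp only: of_nat_eq_iff)
qed

subsection \<open>Density by averaging over translates\<close>

text \<open>Double counting of the pairs \<open>(p, t)\<close> with \<open>p + t\<close> in
  \<open>S\<close>.\<close>

lemma sum_card_translates:
  fixes B S :: "'a::ab_group_add set"
  assumes "finite B" "finite F"
  shows "(\<Sum>p\<in>B. card {t\<in>F. p + t \<in> S}) = (\<Sum>t\<in>F. card {p\<in>B. p + t \<in> S})"
proof -
  have "(\<Sum>p\<in>B. card {t\<in>F. p + t \<in> S}) = (\<Sum>p\<in>B. \<Sum>t\<in>F. if p + t \<in> S then 1 else 0)"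
    using assms by (simp add: sum.inter_filter[symmetric])
  also have "\<dots> = (\<Sum>t\<in>F. \<Sum>p\<in>B. if p + t \<in> S then 1 else 0)"
    by (rule sum.swap)
  also have "\<dots> = (\<Sum>t\<in>F. card {p\<in>B. p + t \<in> S})"
    using assms by (simp add: sum.inter_filter[symmetric])
  finally show ?thesis .
qed

text \<open>After double counting, each fixed \<open>t\<close> contributes at most
  \<open>card (S \<inter> B')\<close>, because translation by \<open>t\<close> is injective and maps
  \<open>B\<close> into \<open>B'\<close>.\<close>

lemma translate_lower_bound:
  fixes S :: "'a::ab_group_add set"
  assumes "finite B" "finite B'" "finite F"
    and sub: "\<And>p t. p \<in> B \<Longrightarrow> t \<in> F \<Longrightarrow> p + t \<in> B'"
    and m: "\<And>p. m \<le> card {t\<in>F. p + t \<in> S}"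
  shows "m * card B \<le> card F * card (S \<inter> B')"
proof -
  have "m * card B = (\<Sum>p\<in>B. m)" by simp
  also have "\<dots> \<le> (\<Sum>p\<in>B. card {t\<in>F. p + t \<in> S})" by (rule sum_mono) (rule m)
  also have "\<dots> = (\<Sum>t\<in>F. card {p\<in>B. p + t \<in> S})" using assms by (simp add: sum_card_translates)
  also have "\<dots> \<le> (\<Sum>t\<in>F. card (S \<inter> B'))"
  proof (rule sum_mono)
    fix t assume "t \<in> F"
    show "card {p\<in>B. p + t \<in> S} \<le> card (S \<inter> B')"
      by (rule card_inj_on_le[where f = "\<lambda>p. p + t"]) (use assms \<open>t \<in> F\<close> in \<open>auto simp: inj_on_def\<close>)
  qed
  finally show ?thesis by simp
qed

text \<open>Now \<open>B'\<close> holds the base points: a point of \<open>S \<inter> B\<close> is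
  hit by offset \<open>t\<close> from the base point obtained by subtracting \<open>t\<close>, which
  lies in \<open>B'\<close>.\<close>

lemma translate_upper_bound:
  fixes S :: "'a::ab_group_add set"
  assumes "finite B" "finite B'" "finite F"
    and sub: "\<And>p t. p \<in> B \<Longrightarrow> t \<in> F \<Longrightarrow> p - t \<in> B'"
    and m: "\<And>p. card {t\<in>F. p + t \<in> S} \<le> m"
  shows "card F * card (S \<inter> B) \<le> m * card B'"
proof -
  have "card F * card (S \<inter> B) = (\<Sum>t\<in>F. card (S \<inter> B))" by simp
  also have "\<dots> \<le> (\<Sum>t\<in>F. card {p\<in>B'. p + t \<in> S})"
  proof (rule sum_mono)
    fix t assume "t \<in> F"
    show "card (S \<inter> B) \<le> card {p\<in>B'. p + t \<in> S}"
      by (rule card_inj_on_le[where f = "\<lambda>p. p - t"]) (use assms \<open>t \<in> F\<close> in \<open>auto simp: inj_on_def\<close>)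
  qed
  also have "\<dots> = (\<Sum>p\<in>B'. card {t\<in>F. p + t \<in> S})" using assms by (simp add: sum_card_translates)
  also have "\<dots> \<le> (\<Sum>p\<in>B'. m)" by (rule sum_mono) (rule m)
  finally show ?thesis by (simp add: mult.commute)
qed

text \<open>Windows based in the ball of radius \<open>n - k\<close> stay inside the ball of radius
  \<open>n\<close>. The ratio of the two ball sizes tends to 1, so the boundary loss vanishes in the
  limit.\<close>

lemma set_density_SQ_ge:
  assumes F: "finite F" "F \<noteq> {}" "\<And>t. t \<in> F \<Longrightarrow> l1_dist 0 t \<le> int k"
    and m: "\<And>p. m \<le> card {t\<in>F. p + t \<in> S}"
  shows "ereal (real m / real (card F)) \<le> set_density SQ v S"
proof -
  let ?B = "graph_ball SQ v"
  define c where "c = real m / real (card F)"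
  \<comment> \<open>The subtraction is over the reals, hence not truncated; the finitely many
    \<open>n < k\<close> do not affect the limsup.\<close>
  define h where "h n = c * ((2 * (real n - real k)\<^sup>2 + 2 * (real n - real k) + 1) /
      (2 * (real n)\<^sup>2 + 2 * real n + 1))" for n
  have cF: "card F > 0" using F by (simp add: card_gt_0_iff)
  have "h n \<le> real (card (S \<inter> ?B n)) / real (card (?B n))" if "k \<le> n" for n
  proof -
    define r where "r = n - k"
    then have n: "n = r + k" using that by simp
    have "m * card (?B r) \<le> card F * card (S \<inter> ?B n)"
    proof (rule translate_lower_bound)
      fix p t assume "p \<in> ?B r" "t \<in> F"
      then have "l1_dist v p \<le> int r" "l1_dist 0 t \<le> int k"
        using F by (auto simp: mem_graph_ball_SQ_iff)
      then show "p + t \<in> ?B n"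
        unfolding mem_graph_ball_SQ_iff l1_dist_def n by simp
    qed (use F m in \<open>auto simp: finite_graph_ball_SQ\<close>)
    then have "real m * real (card (?B r)) \<le> real (card F) * real (card (S \<inter> ?B n))"
      by (simp only: of_nat_mult[symmetric] of_nat_le_iff)
    then have "c * real (card (?B r)) \<le> real (card (S \<inter> ?B n))"
      using cF by (simp add: c_def field_simps)
    then have "c * real (card (?B r)) / real (card (?B n)) \<le>
        real (card (S \<inter> ?B n)) / real (card (?B n))"
      by (rule divide_right_mono) simp
    then show ?thesis
      by (simp add: h_def card_graph_ball_SQ n algebra_simps)
  qed
  then have ev: "eventually (\<lambda>n. ereal (h n) \<le>
      ereal (real (card (S \<inter> ?B n)) / real (card (?B n)))) sequentially"
    by (auto simp: eventually_sequentially)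
  have "(\<lambda>n. (2 * (real n - real k)\<^sup>2 + 2 * (real n - real k) + 1) /
      (2 * (real n)\<^sup>2 + 2 * real n + 1)) \<longlonglongrightarrow> 1"
    by real_asymp
  then have "h \<longlonglongrightarrow> c" unfolding h_def by (rule tendsto_mult_left[of _ 1 _ c, unfolded mult_1_right])
  then have "limsup (\<lambda>n. ereal (h n)) = ereal c"
    by (intro lim_imp_Limsup) auto
  then show ?thesis
    using Limsup_mono[OF ev] by (simp add: set_density_def c_def)
qed

text \<open>Every window that hits the ball of radius \<open>n\<close> is based in the ball of
  radius \<open>n + k\<close>, and again the ratio of sizes tends to 1.\<close>

lemma set_density_SQ_le:
  assumes F: "finite F" "F \<noteq> {}" "\<And>t. t \<in> F \<Longrightarrow> l1_dist 0 t \<le> int k"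
    and m: "\<And>p. card {t\<in>F. p + t \<in> S} \<le> m"
  shows "set_density SQ v S \<le> ereal (real m / real (card F))"
proof -
  let ?B = "graph_ball SQ v"
  define c where "c = real m / real (card F)"
  define h where "h n = c * ((2 * (real n + real k)\<^sup>2 + 2 * (real n + real k) + 1) /
      (2 * (real n)\<^sup>2 + 2 * real n + 1))" for n
  have cF: "card F > 0" using F by (simp add: card_gt_0_iff)
  have "real (card (S \<inter> ?B n)) / real (card (?B n)) \<le> h n" for n
  proof -
    have "card F * card (S \<inter> ?B n) \<le> m * card (?B (n + k))"
    proof (rule translate_upper_bound)
      fix p t assume "p \<in> ?B n" "t \<in> F"
      then have "l1_dist v p \<le> int n" "l1_dist 0 t \<le> int k"
        using F by (auto simp: mem_graph_ball_SQ_iff)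
      then show "p - t \<in> ?B (n + k)"
        unfolding mem_graph_ball_SQ_iff l1_dist_def by simp
    qed (use F m in \<open>auto simp: finite_graph_ball_SQ\<close>)
    then have "real (card F) * real (card (S \<inter> ?B n)) \<le> real m * real (card (?B (n + k)))"
      by (simp only: of_nat_mult[symmetric] of_nat_le_iff)
    then have "real (card (S \<inter> ?B n)) \<le> c * real (card (?B (n + k)))"
      using cF by (simp add: c_def field_simps)
    then have "real (card (S \<inter> ?B n)) / real (card (?B n)) \<le>
        c * real (card (?B (n + k))) / real (card (?B n))"
      by (rule divide_right_mono) simp
    then show ?thesis
      by (simp add: h_def card_graph_ball_SQ algebra_simps)
  qed
  then have ev: "eventually (\<lambda>n.
      ereal (real (card (S \<inter> ?B n)) / real (card (?B n))) \<le> ereal (h n)) sequentially"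
    by simp
  have "(\<lambda>n. (2 * (real n + real k)\<^sup>2 + 2 * (real n + real k) + 1) /
      (2 * (real n)\<^sup>2 + 2 * real n + 1)) \<longlonglongrightarrow> 1"
    by real_asymp
  then have "h \<longlonglongrightarrow> c" unfolding h_def by (rule tendsto_mult_left[of _ 1 _ c, unfolded mult_1_right])
  then have "limsup (\<lambda>n. ereal (h n)) = ereal c"
    by (intro lim_imp_Limsup) auto
  then show ?thesis
    using Limsup_mono[OF ev] by (simp add: set_density_def c_def)
qed

subsection \<open>Lower bound\<close>

definition nbr_offsets :: "(int \<times> int) list" where
  "nbr_offsets = [(1, 0), (- 1, 0), (0, 1), (0, - 1)]"

lemma l1_dist_eq_1_iff: "l1_dist 0 t = 1 \<longleftrightarrow> t \<in> set nbr_offsets"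
proof
  assume t: "l1_dist 0 t = 1"
  obtain x y where "t = (x, y)" by (cases t)
  with t have "\<bar>x\<bar> + \<bar>y\<bar> = 1" by (simp add: l1_dist_def)
  then have "x = 0 \<and> y = 1 \<or> x = 0 \<and> y = -1 \<or> x = 1 \<and> y = 0 \<or> x = -1 \<and> y = 0" by arith
  then show "t \<in> set nbr_offsets" using \<open>t = (x, y)\<close> by (auto simp: nbr_offsets_def)
qed (auto simp: nbr_offsets_def l1_dist_def)

lemma SQ_iff_offset: "SQ u v \<longleftrightarrow> v - u \<in> set nbr_offsets"
proof -
  have "l1_dist u v = l1_dist 0 (v - u)" by (simp add: l1_dist_def abs_minus_commute)
  then show ?thesis by (simp add: SQ_iff_l1_dist l1_dist_eq_1_iff)
qed

lemma LD_set_dominated: "LD_set G S \<Longrightarrow> v \<notin> S \<Longrightarrow> \<exists>u\<in>S. G v u"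
  unfolding LD_set_def open_nbhd_def by blast

lemma RED_LD_set_dominated_twice:
  assumes S: "RED_LD_set G S"
  obtains a b where "a \<in> S" "b \<in> S" "a \<noteq> b" "a = v \<or> G v a" "b = v \<or> G v b"
proof (cases "v \<in> S")
  case True
  then have "LD_set G (S - {v})" using S by (simp add: RED_LD_set_def)
  then obtain b where "b \<in> S - {v}" "G v b" using LD_set_dominated[of G "S - {v}" v] by blast
  then show ?thesis using that[of v b] True by blast
next
  case False
  have "LD_set G S" using S by (simp add: RED_LD_set_def)
  then obtain a where a: "a \<in> S" "G v a" using LD_set_dominated[of G S v] False by blast
  \<comment> \<open>The detector just found is the one to remove: \<open>v\<close> must then be
    dominated by another one.\<close>
  then have "LD_set G (S - {a})" using S by (simp add: RED_LD_set_def)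
  then obtain b where "b \<in> S - {a}" "G v b" using LD_set_dominated[of G "S - {a}" v] False by blast
  then show ?thesis using that[of a b] a by blast
qed

lemma RED_LD_set_SQ_density_ge:
  assumes "RED_LD_set SQ S"
  shows "ereal (2 / 5) \<le> set_density SQ v S"
proof -
  let ?F = "insert 0 (set nbr_offsets)"
  have card_F: "card ?F = 5" by (simp add: nbr_offsets_def prod_eq_iff zero_prod_def)
  have "2 \<le> card {t\<in>?F. p + t \<in> S}" for p
  proof -
    obtain a b where ab: "a \<in> S" "b \<in> S" "a \<noteq> b" "a = p \<or> SQ p a" "b = p \<or> SQ p b"
      using RED_LD_set_dominated_twice[OF assms, of p] by metis
    then have "{a - p, b - p} \<subseteq> {t\<in>?F. p + t \<in> S}"
      by (auto simp: SQ_iff_offset)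
    then have "card {a - p, b - p} \<le> card {t\<in>?F. p + t \<in> S}"
      by (intro card_mono) auto
    then show ?thesis using ab by simp
  qed
  moreover have "l1_dist 0 t \<le> int 1" if "t \<in> ?F" for t
    using that l1_dist_eq_1_iff[of t] by (auto simp: l1_dist_def)
  ultimately have "ereal (real 2 / real (card ?F)) \<le> set_density SQ v S"
    by (intro set_density_SQ_ge[where k = 1]) auto
  then show ?thesis by (simp add: card_F)
qed

subsection \<open>Upper bound\<close>

text \<open>The symmetric difference of the neighbourhoods of \<open>p\<close> and
  \<open>p + d\<close>, seen from \<open>p\<close>: a detector there tells the two apart. Lists keep
  the later check executable.\<close>

definition sep_offsets :: "int \<times> int \<Rightarrow> (int \<times> int) list" where
  "sep_offsets d = [e \<leftarrow> nbr_offsets. e - d \<notin> set nbr_offsets] @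
     [e \<leftarrow> map ((+) d) nbr_offsets. e \<notin> set nbr_offsets]"

text \<open>The displacements between distinct vertices with a common neighbour.\<close>

definition dist2_offsets :: "(int \<times> int) list" where
  "dist2_offsets =
     map (\<lambda>(e, e'). e - e') [(e, e') \<leftarrow> List.product nbr_offsets nbr_offsets. e \<noteq> e']"

text \<open>
  When \<open>p\<close> needs to be located, either \<open>p\<close> is the removed detector, and a single detector other
  than \<open>p\<close> suffices, or \<open>p \<notin> S\<close> and any detector may have been removed, so that two are needed.
\<close>

definition robust_at :: "(int \<times> int) set \<Rightarrow> int \<times> int \<Rightarrow> (int \<times> int) list \<Rightarrow> bool" where
  "robust_at S p es \<longleftrightarrow>
     (if p \<in> S then 1 else 2) \<le> length [e \<leftarrow> es. e \<noteq> 0 \<and> p + e \<in> S]"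

lemma distinct_nbr_offsets: "distinct nbr_offsets"
  by (simp add: nbr_offsets_def)

lemma distinct_sep_offsets: "distinct (sep_offsets d)"
  by (auto simp: sep_offsets_def distinct_nbr_offsets distinct_map)

text \<open>Removing \<open>w\<close> spoils only the offset \<open>w - p\<close>, so two detectors
  suffice. If \<open>p\<close> is in \<open>S\<close>, then \<open>w = p\<close> and the spoiled
  offset is 0, which \<open>robust_at\<close> does not count.\<close>

lemma robust_at_witness:
  assumes "robust_at S p es" "distinct es" "p \<notin> S - {w}"
  obtains e where "e \<in> set es" "p + e \<in> S - {w}"
proof -
  let ?E = "{e \<in> set es. e \<noteq> 0 \<and> p + e \<in> S}"
  have card_E: "(if p \<in> S then 1 else 2) \<le> card ?E"
    using assms(1,2) distinct_card[of "[e \<leftarrow> es. e \<noteq> 0 \<and> p + e \<in> S]"]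
    by (simp add: robust_at_def)
  have "\<exists>e\<in>?E. p + e \<noteq> w"
  proof (rule ccontr)
    assume "\<not> ?thesis"
    then have sub: "?E \<subseteq> {w - p}" by (auto simp: eq_diff_eq add.commute simp del: split_paired_All split_paired_Ex)
    show False
    proof (cases "p \<in> S")
      case True
      then have "w = p" using assms(3) by simp
      then have "?E = {}" using sub by auto
      then show False using card_E True by (simp only: card.empty) simp
    next
      case False
      have "card ?E \<le> card {w - p}" using sub by (intro card_mono) auto
      then show False using card_E False by simp
    qed
  qed
  then show ?thesis using that by blast
qed

lemma diff_mem_dist2_offsets:
  assumes "e \<in> set nbr_offsets" "e' \<in> set nbr_offsets" "e \<noteq> e'"
  shows "e - e' \<in> set dist2_offsets"
  unfolding dist2_offsets_def set_map set_filter set_product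
  using assms by (intro image_eqI[of _ _ "(e, e')"]) auto

text \<open>Separation is checked only for vertices with a common neighbour, since domination
  separates all other pairs. As \<open>w\<close> need not lie in \<open>S\<close>, the case of no
  removal is included.\<close>

lemma LD_set_SQ_remove:
  assumes dom: "\<And>p. robust_at S p nbr_offsets"
    and sep: "\<And>p d. d \<in> set dist2_offsets \<Longrightarrow> p + d \<notin> S \<Longrightarrow> robust_at S p (sep_offsets d)"
  shows "LD_set SQ (S - {w})"
proof -
  let ?T = "S - {w}"
  have dominated: "\<exists>z\<in>?T. SQ u z" if "u \<notin> ?T" for u
  proof -
    obtain e where "e \<in> set nbr_offsets" "u + e \<in> ?T"
      using robust_at_witness[OF dom distinct_nbr_offsets \<open>u \<notin> ?T\<close>] .
    then show ?thesis by (intro bexI[of _ "u + e"]) (auto simp: SQ_iff_offset)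
  qed
  have separated: "open_nbhd SQ u \<inter> ?T \<noteq> open_nbhd SQ v \<inter> ?T"
    if "u \<notin> ?T" "v \<notin> S" "u \<noteq> v" for u v
  proof
    assume eq: "open_nbhd SQ u \<inter> ?T = open_nbhd SQ v \<inter> ?T"
    \<comment> \<open>Equal traces are nonempty, so \<open>u\<close> and \<open>v\<close> share a
      detector \<open>z\<close>, and \<open>v - u\<close> is a difference of two neighbour
      offsets.\<close>
    obtain z where "z \<in> ?T" "SQ u z" using dominated \<open>u \<notin> ?T\<close> by blast
    then have "SQ v z" using eq by (auto simp: open_nbhd_def)
    then have "v - u = (z - u) - (z - v)" "z - u \<in> set nbr_offsets" "z - v \<in> set nbr_offsets"
      using \<open>SQ u z\<close> by (auto simp: SQ_iff_offset)
    then have "v - u \<in> set dist2_offsets"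
      using \<open>u \<noteq> v\<close> diff_mem_dist2_offsets[of "z - u" "z - v"] by simp
    then have "robust_at S u (sep_offsets (v - u))"
      using sep[of "v - u" u] \<open>v \<notin> S\<close> by simp
    then obtain e where e: "e \<in> set (sep_offsets (v - u))" "u + e \<in> ?T"
      using robust_at_witness[OF _ distinct_sep_offsets \<open>u \<notin> ?T\<close>] by blast
    have "SQ u (u + e) \<noteq> SQ v (u + e)"
      using e(1) by (auto simp: SQ_iff_offset sep_offsets_def algebra_simps)
    then show False using eq e(2) by (auto simp: open_nbhd_def)
  qed
  show ?thesis
    unfolding LD_set_def
  proof (intro ballI conjI impI)
    fix u v assume uv: "u \<in> UNIV - ?T" "v \<in> UNIV - ?T"
    show "open_nbhd SQ v \<inter> ?T \<noteq> {}"
      using dominated[of v] uv by (auto simp: open_nbhd_def)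
    assume "u \<noteq> v"
    \<comment> \<open>Only \<open>w\<close> can be both in \<open>S\<close> and outside
      \<open>S - {w}\<close>. This is why \<open>sep\<close> may assume that one vertex of the pair
      is outside \<open>S\<close>.\<close>
    then have "u \<notin> S \<or> v \<notin> S" using uv by auto
    then show "open_nbhd SQ v \<inter> ?T \<noteq> open_nbhd SQ u \<inter> ?T"
      using separated[of u v] separated[of v u] uv \<open>u \<noteq> v\<close> by auto
  qed
qed

section \<open>A doubly periodic detector set\<close>

definition tile :: "int \<Rightarrow> int \<Rightarrow> bool" where
  "tile x y \<longleftrightarrow> (if even y then (x - 2 * y) mod 8 \<in> {0, 2, 3, 5, 6} else x mod 4 = 0)"

definition tiling :: "(int \<times> int) set" where
  "tiling = {(x, y). tile x y}"

text \<open>The shift \<open>2 * y\<close> moves the even-row pattern by 4 every two rows, hence by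
  a full period 8 every four rows. Only the base point is reduced, so offsets \<open>(a, b)\<close>
  survive unchanged.\<close>

lemma tile_mod: "tile (x + a) (y + b) \<longleftrightarrow> tile (x mod 8 + a) (y mod 4 + b)"
proof -
  have "even (y + b) \<longleftrightarrow> even (y mod 4 + b)"
    by (simp add: dvd_mod_iff[of 2 4])
  moreover have "(x + a - 2 * (y + b)) mod 8 = (x mod 8 + a - 2 * (y mod 4 + b)) mod 8"
  proof -
    have "x + a - 2 * (y + b) - (x mod 8 + a - 2 * (y mod 4 + b)) = 8 * (x div 8 - y div 4)"
      by (simp add: minus_mult_div_eq_mod[symmetric] algebra_simps)
    then show ?thesis by (metis dvd_triv_left mod_eq_dvd_iff)
  qed
  moreover have "(x + a) mod 4 = 0 \<longleftrightarrow> (x mod 8 + a) mod 4 = 0"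
  proof -
    have "x + a - (x mod 8 + a) = 4 * (2 * (x div 8))"
      by (simp add: minus_mult_div_eq_mod[symmetric])
    then show ?thesis by (metis dvd_triv_left mod_eq_dvd_iff)
  qed
  ultimately show ?thesis unfolding tile_def by simp
qed

lemma mem_tiling_mod:
  "(x, y) + e \<in> tiling \<longleftrightarrow> (x mod 8, y mod 4) + e \<in> tiling"
  by (cases e) (simp add: tiling_def tile_mod[symmetric])

text \<open>A rectangle for the sublattice spanned by (8,0) and (0,4), which lets the coordinates be
  reduced independently.\<close>

definition residues_8_4 :: "(int \<times> int) list" where
  "residues_8_4 = List.product [0, 1, 2, 3, 4, 5, 6, 7] [0, 1, 2, 3]"

lemma residues_8_4: "(x mod 8, y mod 4) \<in> set residues_8_4"
proof -
  have "x mod 8 \<in> {0, 1, 2, 3, 4, 5, 6, 7}" by (simp, presburger)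
  moreover have "y mod 4 \<in> {0, 1, 2, 3}" by (simp, presburger)
  ultimately show ?thesis
    unfolding residues_8_4_def set_product by (intro SigmaI) (simp_all only: list.set)
qed

lemma tiling_robust_reduce:
  "robust_at tiling (x, y) es \<longleftrightarrow> robust_at tiling (x mod 8, y mod 4) es"
proof -
  have "[e \<leftarrow> es. e \<noteq> 0 \<and> (x, y) + e \<in> tiling] =
      [e \<leftarrow> es. e \<noteq> 0 \<and> (x mod 8, y mod 4) + e \<in> tiling]"
    using mem_tiling_mod[of x y] by simp
  moreover have "(x, y) \<in> tiling \<longleftrightarrow> (x mod 8, y mod 4) \<in> tiling"
    using mem_tiling_mod[of x y 0] by (simp only: add_0_right)
  ultimately show ?thesis unfolding robust_at_def by (simp only:)
qed

lemma tiling_dom_check: "\<forall>p\<in>set residues_8_4. robust_at tiling p nbr_offsets"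
  \<comment> \<open>Membership in the infinite set becomes the computable predicate
    \<open>tile\<close>.\<close>
  unfolding robust_at_def tiling_def mem_Collect_eq by code_simp

lemma tiling_sep_check:
  "\<forall>p\<in>set residues_8_4. \<forall>d\<in>set dist2_offsets.
     p + d \<in> tiling \<or> robust_at tiling p (sep_offsets d)"
  unfolding robust_at_def tiling_def mem_Collect_eq by code_simp

lemma RED_LD_set_tiling: "RED_LD_set SQ tiling"
proof -
  have LD: "LD_set SQ (tiling - {w})" for w
  proof (rule LD_set_SQ_remove)
    fix p :: "int \<times> int"
    obtain x y where p: "p = (x, y)" by (cases p)
    show "robust_at tiling p nbr_offsets"
      using tiling_dom_check residues_8_4[of x y] tiling_robust_reduce[of x y] unfolding p by blast
    fix d assume "d \<in> set dist2_offsets" "p + d \<notin> tiling"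
    then show "robust_at tiling p (sep_offsets d)"
      using tiling_sep_check residues_8_4[of x y] tiling_robust_reduce[of x y]
        mem_tiling_mod[of x y d] unfolding p by blast
  qed
  \<comment> \<open>Removing a non-detector changes nothing, so \<open>LD\<close> also yields the
    set itself.\<close>
  have "(1, 0) \<notin> tiling" by (simp add: tiling_def tile_def)
  then have "LD_set SQ tiling" using LD[of "(1, 0)"] by simp
  then show ?thesis using LD by (simp add: RED_LD_set_def)
qed

section \<open>Density of the periodic set\<close>

definition box_8_2 :: "(int \<times> int) list" where
  "box_8_2 = List.product [0, 1, 2, 3, 4, 5, 6, 7] [0, 1]"

text \<open>Of two consecutive rows, the even one has 5 and the odd one 2 detectors in any 8
  consecutive columns.\<close>

lemma tiling_box_check:
  "\<forall>p\<in>set residues_8_4. length [t \<leftarrow> box_8_2. p + t \<in> tiling] = 7"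
  unfolding tiling_def mem_Collect_eq by code_simp

lemma set_density_tiling: "set_density SQ v tiling \<le> ereal (7 / 16)"
proof -
  have dist: "distinct box_8_2" by (simp add: box_8_2_def)
  have "card {t \<in> set box_8_2. p + t \<in> tiling} = 7" for p
  proof -
    have "card {t \<in> set box_8_2. p + t \<in> tiling} = length [t \<leftarrow> box_8_2. p + t \<in> tiling]"
      using dist distinct_card[of "[t \<leftarrow> box_8_2. p + t \<in> tiling]"] by simp
    also have "\<dots> = 7"
    proof (cases p)
      case (Pair x y)
      have "[t \<leftarrow> box_8_2. p + t \<in> tiling] = [t \<leftarrow> box_8_2. (x mod 8, y mod 4) + t \<in> tiling]"
        unfolding Pair using mem_tiling_mod[of x y] by simp
      then show ?thesis using tiling_box_check residues_8_4[of x y] by simp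
    qed
    finally show ?thesis .
  qed
  \<comment> \<open>The farthest corner (7,1) of the box is at distance 8.\<close>
  moreover have "l1_dist 0 t \<le> int 8" if "t \<in> set box_8_2" for t
    using that by (auto simp: box_8_2_def l1_dist_def)
  ultimately have "set_density SQ v tiling \<le> ereal (real 7 / real (card (set box_8_2)))"
    by (intro set_density_SQ_le[where k = 8]) (auto simp: box_8_2_def)
  moreover have "card (set box_8_2) = 16"
    using distinct_card[OF dist] by (simp add: box_8_2_def)
  ultimately show ?thesis by simp
qed

theorem theorem20:
  fixes v :: "int \<times> int"
  shows "ereal (2 / 5) \<le> RED_LD_density SQ v \<and> RED_LD_density SQ v \<le> ereal (7 / 16)"
proof
  show "ereal (2 / 5) \<le> RED_LD_density SQ v"
    unfolding RED_LD_density_def by (rule INF_greatest) (simp add: RED_LD_set_SQ_density_ge)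
  have "RED_LD_density SQ v \<le> set_density SQ v tiling"
    unfolding RED_LD_density_def by (rule INF_lower) (simp add: RED_LD_set_tiling)
  also have "\<dots> \<le> ereal (7 / 16)" by (rule set_density_tiling)
  finally show "RED_LD_density SQ v \<le> ereal (7 / 16)" .
qed

end
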